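(* Let $f=\sum_{i=1}^m f_i$ with $f_i:\mathbb{R}^d\to\mathbb{R}$. Assume that: (i) each $f_i$ is convex and has $L$-Lipschitz continuous gradient, i.e. $f_i(x)+\langle\nabla f_i(x),y-x\rangle\le f_i(y)\le f_i(x)+\langle\nabla f_i(x),y-x\rangle+\frac L2\|y-x\|^2$ for all $x,y\in\mathbb{R}^d$; (ii) $f_i(x)=\ell(a_i^Tx,b_i)$ with $a_i\in\mathbb{R}^d$, $b_i\in\mathbb{R}$, and $\mathrm{supp}(\nabla f_i(x))=\mathrm{supp}(a_i)$ for every $x$ and $i$. Let $\Delta=\min(\Delta_{\rm ave},\Delta_{\max})$ and $\bar L=L\sqrt{m(1+\Delta)}$. Let $Q$ be an unbiased random quantizer with variance parameter $\alpha$. Then the iterates $x_{k+1}=x_k-\gamma_kQ(\nabla f(x_k))$ with $\gamma_k=1/(\bar L\alpha)$ satisfy, for every $T\in\mathbb{N}$, $$\mathbf{E}\left(f(x_T)-f^\star\right)\le\frac{\alpha\bar L}{2(T+1)}\|x_0-x^\star\|^2.$$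
   Context: $\|\cdot\|$ is the Euclidean norm and $\mathrm{supp}(x)=\{i: x^i\ne0\}$. $x^\star$ is a minimizer of $f$ (assumed to exist) and $f^\star=f(x^\star)$. $x_0\in\mathbb{R}^d$ is a deterministic initial point. Conflict graph degrees: $\Delta_{\rm ave}=\frac1m\sum_{i=1}^m\sum_{j\ne i}\mathbf 1\{\mathrm{supp}(a_i)\cap\mathrm{supp}(a_j)\ne\emptyset\}$ and $\Delta_{\max}=\max_{i}\sum_{j\ne i}\mathbf 1\{\mathrm{supp}(a_i)\cap\mathrm{supp}(a_j)\ne\emptyset\}$. An unbiased random quantizer (URQ) with parameter $\alpha$ (finite, positive) is a random mapping $Q:\mathbb{R}^d\to\mathbb{R}^d$ such that for every $v\in\mathbb{R}^d$: $\mathrm{supp}(Q(v))\subseteq\mathrm{supp}(v)$, $\mathbf{E}\{Q(v)\}=v$, and $\mathbf{E}\{\|Q(v)\|^2\}\le\alpha\|v\|^2$. Each application of $Q$ in the algorithm uses fresh randomness, so these properties hold conditionally on the past iterates. *)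

theory Defs
  imports "HOL-Probability.Probability"
begin

definition supp :: "real ^ 'd \<Rightarrow> 'd set" where
  "supp x = {i. x $ i \<noteq> 0}"

definition grad :: "('a::real_inner \<Rightarrow> real) \<Rightarrow> 'a \<Rightarrow> 'a" where
  "grad f x = (THE D. GDERIV f x :> D)"

text \<open>Differentiability is stated explicitly: without it, \<open>grad\<close> would be an unspecified vector.\<close>

definition convex_lipschitz_grad :: "real \<Rightarrow> ('a::real_inner \<Rightarrow> real) \<Rightarrow> bool" where
  "convex_lipschitz_grad L f \<longleftrightarrow>
     (\<forall>x. f differentiable (at x)) \<and>
     (\<forall>x y. f x + grad f x \<bullet> (y - x) \<le> f y \<and>
            f y \<le> f x + grad f x \<bullet> (y - x) + L / 2 * (norm (y - x))\<^sup>2)"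

definition conflict_degree :: "nat \<Rightarrow> (nat \<Rightarrow> real ^ 'd) \<Rightarrow> nat \<Rightarrow> real" where
  "conflict_degree m a i =
     (\<Sum>j \<in> {1..m} - {i}. of_bool (supp (a i) \<inter> supp (a j) \<noteq> {}))"

definition Delta_ave :: "nat \<Rightarrow> (nat \<Rightarrow> real ^ 'd) \<Rightarrow> real" where
  "Delta_ave m a = (\<Sum>i=1..m. conflict_degree m a i) / real m"

definition Delta_max :: "nat \<Rightarrow> (nat \<Rightarrow> real ^ 'd) \<Rightarrow> real" where
  "Delta_max m a = Max (conflict_degree m a ` {1..m})"

definition Lbar :: "real \<Rightarrow> nat \<Rightarrow> (nat \<Rightarrow> real ^ 'd) \<Rightarrow> real" where
  "Lbar L m a = L * sqrt (real m * (1 + min (Delta_ave m a) (Delta_max m a)))"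

text \<open>
  A random mapping is a function \<open>Q s v\<close> of a random seed \<open>s\<close>, drawn from the probability
  space \<open>S\<close>, and of the vector \<open>v\<close>. Joint measurability makes \<open>Q\<close> applied to a random vector
  again a random vector. Integrability is stated explicitly because the Bochner integral of a
  non-integrable function is \<open>0\<close>; for \<open>Q\<close> itself it is part of \<open>has_bochner_integral\<close>.
\<close>

definition unbiased_random_quantizer ::
    "'s measure \<Rightarrow> real \<Rightarrow> ('s \<Rightarrow> real ^ 'd \<Rightarrow> real ^ 'd) \<Rightarrow> bool" where
  "unbiased_random_quantizer S \<alpha> Q \<longleftrightarrow>
     prob_space S \<and> 0 < \<alpha> \<and>
     (\<lambda>(s, v). Q s v) \<in> borel_measurable (S \<Otimes>\<^sub>M borel) \<and>
     (\<forall>v. (AE s in S. supp (Q s v) \<subseteq> supp v) \<and>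
          has_bochner_integral S (\<lambda>s. Q s v) v \<and>
          integrable S (\<lambda>s. (norm (Q s v))\<^sup>2) \<and>
          (LINT s|S. (norm (Q s v))\<^sup>2) \<le> \<alpha> * (norm v)\<^sup>2)"

text \<open>
  Quantized gradient iterates from the deterministic point \<open>x0\<close>: the \<open>k\<close>-th application of
  \<open>Q\<close> uses the \<open>k\<close>-th entry of the seed sequence \<open>s\<close>.
\<close>

primrec quantized_gd ::
    "('s \<Rightarrow> real ^ 'd \<Rightarrow> real ^ 'd) \<Rightarrow> (real ^ 'd \<Rightarrow> real) \<Rightarrow> (nat \<Rightarrow> real) \<Rightarrow> real ^ 'd
      \<Rightarrow> (nat \<Rightarrow> 's) \<Rightarrow> nat \<Rightarrow> real ^ 'd" where
  "quantized_gd Q f \<gamma> x0 s 0 = x0"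
| "quantized_gd Q f \<gamma> x0 s (Suc k) =
     quantized_gd Q f \<gamma> x0 s k - \<gamma> k *\<^sub>R Q (s k) (grad f (quantized_gd Q f \<gamma> x0 s k))"

text \<open>
  Fresh randomness: the seeds are independent random variables on \<open>M\<close>, each distributed as \<open>S\<close>.
\<close>

definition fresh_seeds :: "'w measure \<Rightarrow> 's measure \<Rightarrow> (nat \<Rightarrow> 'w \<Rightarrow> 's) \<Rightarrow> bool" where
  "fresh_seeds M S \<xi> \<longleftrightarrow>
     prob_space M \<and> prob_space.indep_vars M (\<lambda>_. S) \<xi> UNIV \<and> (\<forall>k. distr M S (\<xi> k) = S)"

end

theory Submission
  imports Defs
begin

text \<open>
  Write \<open>\<Lambda>\<close> for \<open>Lbar L m a\<close>, \<open>c = 1 / (\<Lambda> * \<alpha>)\<close> for the step size, and \<open>x*\<close> for the minimizer.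

  The combinatorial half of the argument shows that \<open>f\<close> is \<open>\<Lambda>\<close>-smooth
  (\<open>convex_lipschitz_grad_sum_ridge\<close>). A summand \<open>f\<^sub>i\<close> depends on \<open>x\<close> only through \<open>a\<^sub>i \<bullet> x\<close>, so its
  quadratic upper bound involves only the component of \<open>y - x\<close> along the unit vector \<open>u\<^sub>i\<close> of \<open>a\<^sub>i\<close>.
  It remains to bound \<open>\<Sum>\<^sub>i (u\<^sub>i \<bullet> d)\<^sup>2\<close>: the largest eigenvalue of \<open>\<Sum>\<^sub>i u\<^sub>i u\<^sub>i\<^sup>T\<close> is that of the Gram
  matrix of the \<open>u\<^sub>i\<close>, hence at most its Frobenius norm. The entries of this matrix are bounded by
  \<open>1\<close> and vanish unless \<open>i = j\<close> or \<open>i\<close> and \<open>j\<close> are in conflict, so the squared Frobenius norm is at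
  most \<open>m * (1 + \<Delta>\<^sub>a\<^sub>v\<^sub>e)\<close>; and an average degree never exceeds the maximal one, so the minimum in
  \<open>\<Lambda>\<close> is the average degree.

  The analytic half tracks two quantities along one step from \<open>x\<close> to \<open>x'\<close>, in conditional
  expectation given \<open>x\<close>:
  \<^item> \<open>E \<parallel>x' - x*\<parallel>\<^sup>2 \<le> \<parallel>x - x*\<parallel>\<^sup>2 - 2 * c * (f x - f x*)\<close>. Cocoercivity of the gradient supplies an extra
    term \<open>\<parallel>grad f x\<parallel>\<^sup>2 / (2 * \<Lambda>)\<close>, which cancels the second moment of the quantizer exactly for this
    step size.
  \<^item> \<open>E (f x') \<le> f x\<close>, from the quadratic upper bound.

  Hence \<open>2 * c * k * E (f x\<^sub>k - f x*) + E \<parallel>x\<^sub>k - x*\<parallel>\<^sup>2\<close> is nonincreasing in \<open>k\<close>. One further use of the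
  first inequality, together with \<open>0 \<le> E \<parallel>x\<^sub>T\<^sub>+\<^sub>1 - x*\<parallel>\<^sup>2\<close>, turns the factor \<open>T\<close> into \<open>T + 1\<close>.

  Conditioning is carried out by Tonelli's theorem: \<open>x\<^sub>k\<close> is a function of the seeds before \<open>k\<close>, so
  the joint law of \<open>x\<^sub>k\<close> and the \<open>k\<close>-th seed is a product. Both quantities are nonnegative, so
  integrability is propagated along with the bounds.
\<close>

section \<open>Gradients of smooth convex functions\<close>

lemma GDERIV_grad_eq:
  fixes f :: "'a::real_inner \<Rightarrow> real"
  assumes "GDERIV f x :> D"
  shows "grad f x = D"
proof -
  have "D' = D" if "GDERIV f x :> D'" for D'
  proof -
    have "(\<lambda>h. h \<bullet> D') = (\<lambda>h. h \<bullet> D)"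
      using that assms unfolding gderiv_def by (rule has_derivative_unique)
    then have "(D' - D) \<bullet> D' = (D' - D) \<bullet> D"
      by (rule fun_cong)
    then have "(D' - D) \<bullet> (D' - D) = 0"
      by (simp add: inner_diff_right)
    then show ?thesis by simp
  qed
  then show ?thesis
    unfolding grad_def using assms by blast
qed

text \<open>
  On a Euclidean space a linear functional is an inner product with the vector of its values on the
  basis, so that differentiability already provides a gradient.
\<close>

lemma GDERIV_grad:
  fixes f :: "'a::euclidean_space \<Rightarrow> real"
  assumes "f differentiable (at x)"
  shows "GDERIV f x :> grad f x"
proof -
  obtain f' where f': "(f has_derivative f') (at x)"
    using assms unfolding differentiable_def by blast
  then interpret bounded_linear f' by (rule has_derivative_bounded_linear)
  define D where "D = (\<Sum>b\<in>Basis. f' b *\<^sub>R b)"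
  have "f' h = h \<bullet> D" for h
  proof -
    have "f' h = f' (\<Sum>b\<in>Basis. (h \<bullet> b) *\<^sub>R b)"
      by (simp add: euclidean_representation)
    also have "\<dots> = h \<bullet> D"
      by (simp add: sum scaleR D_def inner_sum_right mult.commute)
    finally show ?thesis .
  qed
  then have "f' = (\<lambda>h. h \<bullet> D)" by blast
  then have "GDERIV f x :> D"
    using f' by (simp add: gderiv_def)
  with GDERIV_grad_eq[OF this] show ?thesis by simp
qed

lemma GDERIV_sum:
  assumes "\<And>i. i \<in> I \<Longrightarrow> GDERIV (f i) x :> D i"
  shows "GDERIV (\<lambda>x. \<Sum>i\<in>I. f i x) x :> (\<Sum>i\<in>I. D i)"
  using assms unfolding gderiv_def inner_sum_right by (intro has_derivative_sum)

lemma convex_lipschitz_gradD: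
  assumes "convex_lipschitz_grad L f"
  shows "f differentiable (at x)"
    and "f x + grad f x \<bullet> (y - x) \<le> f y"
    and "f y \<le> f x + grad f x \<bullet> (y - x) + L / 2 * (norm (y - x))\<^sup>2"
  using assms unfolding convex_lipschitz_grad_def by auto

text \<open>
  Both halves of the assumption are evaluated at \<open>z = y - (grad f y - grad f x) / L\<close>, the gradient
  step from \<open>y\<close> for the convex function \<open>f - grad f x \<bullet> _\<close>, whose minimum is at \<open>x\<close>. The resulting lower
  bound on \<open>f y\<close> improves on the tangent plane at \<open>x\<close> by the decrease achieved in this step.
\<close>

lemma convex_lipschitz_grad_cocoercive:
  assumes f: "convex_lipschitz_grad L f" and "0 < L"
  shows "f x + grad f x \<bullet> (y - x) + (norm (grad f y - grad f x))\<^sup>2 / (2 * L) \<le> f y"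
proof -
  define d where "d = grad f y - grad f x"
  define z where "z = y - (1 / L) *\<^sub>R d"
  have "f x + grad f x \<bullet> (z - x) \<le> f z"
    by (rule convex_lipschitz_gradD(2)[OF f])
  also have "f z \<le> f y + grad f y \<bullet> (z - y) + L / 2 * (norm (z - y))\<^sup>2"
    by (rule convex_lipschitz_gradD(3)[OF f])
  finally have "f x + grad f x \<bullet> (y - x) - grad f x \<bullet> d / L
      \<le> f y - grad f y \<bullet> d / L + L / 2 * (norm d / L)\<^sup>2"
    using \<open>0 < L\<close> by (simp add: z_def inner_diff_right)
  moreover have "L / 2 * (norm d / L)\<^sup>2 = (norm d)\<^sup>2 / (2 * L)"
    using \<open>0 < L\<close> by (simp add: field_simps power2_eq_square)
  moreover have "grad f y \<bullet> d / L - grad f x \<bullet> d / L = 2 * ((norm d)\<^sup>2 / (2 * L))"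
    by (simp add: power2_norm_eq_inner d_def inner_diff_left[of "grad f y"] diff_divide_distrib)
  ultimately show ?thesis
    unfolding d_def[symmetric] by linarith
qed

text \<open>
  Adding the cocoercivity inequality to the one with \<open>x\<close> and \<open>y\<close> exchanged bounds
  \<open>\<parallel>grad f y - grad f x\<parallel>\<^sup>2 / L\<close> by \<open>(grad f y - grad f x) \<bullet> (y - x)\<close>; Cauchy-Schwarz does the rest.
\<close>

lemma convex_lipschitz_grad_norm_diff_le:
  assumes f: "convex_lipschitz_grad L f" and "0 < L"
  shows "norm (grad f y - grad f x) \<le> L * norm (y - x)"
proof -
  define d where "d = grad f y - grad f x"
  have "grad f x \<bullet> (y - x) + grad f y \<bullet> (x - y)
      + (norm (grad f y - grad f x))\<^sup>2 / (2 * L) + (norm (grad f x - grad f y))\<^sup>2 / (2 * L) \<le> 0"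
    using convex_lipschitz_grad_cocoercive[OF assms, of x y]
      convex_lipschitz_grad_cocoercive[OF assms, of y x] by linarith
  then have "(norm d)\<^sup>2 / L \<le> d \<bullet> (y - x)"
    by (simp add: d_def norm_minus_commute inner_diff_left inner_diff_right field_simps)
  also have "\<dots> \<le> norm d * norm (y - x)"
    by (rule norm_cauchy_schwarz)
  finally have "norm d * norm d \<le> norm d * (L * norm (y - x))"
    using \<open>0 < L\<close> by (simp add: field_simps power2_eq_square)
  then show ?thesis
    unfolding d_def[symmetric] using \<open>0 < L\<close>
    by (cases "norm d = 0") (auto simp: mult_le_cancel_left_pos)
qed

lemma borel_measurable_grad:
  fixes f :: "'a::euclidean_space \<Rightarrow> real"
  assumes "convex_lipschitz_grad L f" and "0 < L"
  shows "grad f \<in> borel_measurable borel"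
proof -
  have "L-lipschitz_on UNIV (grad f)"
    using convex_lipschitz_grad_norm_diff_le[OF assms] \<open>0 < L\<close>
    by (intro lipschitz_onI) (auto simp: dist_norm)
  then show ?thesis
    by (rule borel_measurable_continuous_onI[OF lipschitz_on_continuous_on])
qed

lemma borel_measurable_convex_lipschitz_grad:
  fixes f :: "'a::euclidean_space \<Rightarrow> real"
  assumes "convex_lipschitz_grad L f"
  shows "f \<in> borel_measurable borel"
proof -
  have "continuous (at x) f" for x
    using convex_lipschitz_gradD(1)[OF assms] by (rule differentiable_imp_continuous_within)
  then show ?thesis
    by (intro borel_measurable_continuous_onI continuous_at_imp_continuous_on) blast
qed

text \<open>
  A gradient step of length \<open>1 / L\<close> from \<open>xstar\<close> would decrease \<open>f\<close> by at least
  \<open>\<parallel>grad f xstar\<parallel>\<^sup>2 / (2 * L)\<close>.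
\<close>

lemma grad_eq_0_at_minimum:
  assumes f: "convex_lipschitz_grad L f" and "0 < L" and min: "\<And>y. f xstar \<le> f y"
  shows "grad f xstar = 0"
proof -
  define g where "g = grad f xstar"
  have "f xstar \<le> f (xstar - (1 / L) *\<^sub>R g)"
    by (rule min)
  also have "\<dots> \<le> f xstar + g \<bullet> (- ((1 / L) *\<^sub>R g)) + L / 2 * (norm (- ((1 / L) *\<^sub>R g)))\<^sup>2"
    using convex_lipschitz_gradD(3)[OF f, of "xstar - (1 / L) *\<^sub>R g" xstar]
    unfolding g_def by simp
  also have "\<dots> = f xstar - (norm g)\<^sup>2 / (2 * L)"
    using \<open>0 < L\<close> by (simp add: field_simps power2_eq_square flip: power2_norm_eq_inner)
  finally show ?thesis
    using \<open>0 < L\<close> by (simp add: g_def divide_le_0_iff)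
qed

section \<open>Smoothness of the sum through the conflict graph\<close>

text \<open>
  Moving orthogonally to \<open>a\<close> does not change \<open>f\<close>, and by convexity the gradient has no component in
  such directions. Hence \<open>y\<close> may be replaced by \<open>x + p\<close>, where \<open>p\<close> is the projection of \<open>y - x\<close> onto
  the line of \<open>a\<close>. Since \<open>sgn 0 = 0\<close>, the formula also covers a constant \<open>f\<close>.
\<close>

lemma ridge_upper_bound:
  fixes f :: "'a::euclidean_space \<Rightarrow> real"
  assumes f: "convex_lipschitz_grad L f" and ridge: "\<And>x. f x = g (a \<bullet> x)"
  shows "f y \<le> f x + grad f x \<bullet> (y - x) + L / 2 * (sgn a \<bullet> (y - x))\<^sup>2"
proof -
  define c where "c = sgn a \<bullet> (y - x)"
  define p where "p = c *\<^sub>R sgn a"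
  define v where "v = (y - x) - p"
  have "norm a * c = a \<bullet> (y - x)"
    by (cases "a = 0") (simp_all add: c_def sgn_div_norm)
  moreover have "a \<bullet> sgn a = norm a"
    by (cases "a = 0") (simp_all add: sgn_div_norm power2_eq_square flip: power2_norm_eq_inner)
  ultimately have orth: "a \<bullet> v = 0"
    by (simp add: v_def p_def inner_diff_right mult.commute)
  have "grad f x \<bullet> w \<le> 0" if "a \<bullet> w = 0" for w
  proof -
    have "f x + grad f x \<bullet> ((x + w) - x) \<le> f (x + w)"
      by (rule convex_lipschitz_gradD(2)[OF f])
    moreover have "f (x + w) = f x"
      by (simp add: ridge inner_add_right that)
    ultimately show ?thesis by simp
  qed
  from this[of v] this[of "- v"] have grad_orth: "grad f x \<bullet> v = 0"
    using orth by simp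
  have "a \<bullet> y = a \<bullet> (x + p)"
    using orth by (simp add: v_def inner_diff_right inner_add_right)
  then have "f y = f (x + p)"
    by (simp add: ridge)
  also have "\<dots> \<le> f x + grad f x \<bullet> p + L / 2 * (norm p)\<^sup>2"
    using convex_lipschitz_gradD(3)[OF f, of "x + p" x] by simp
  also have "grad f x \<bullet> p = grad f x \<bullet> (y - x)"
    using grad_orth by (simp add: v_def inner_diff_right)
  also have "(norm p)\<^sup>2 = c\<^sup>2"
    by (cases "a = 0") (simp_all add: p_def c_def norm_sgn power_mult_distrib)
  finally show ?thesis by (simp add: c_def)
qed

text \<open>
  A bound on the largest eigenvalue of \<open>\<Sum>\<^sub>i u\<^sub>i u\<^sub>i\<^sup>T\<close> by the Frobenius norm of the Gram matrix. With
  \<open>c\<^sub>i = u\<^sub>i \<bullet> d\<close> and \<open>w = \<Sum>\<^sub>i c\<^sub>i u\<^sub>i\<close>, the left-hand side \<open>C\<close> equals \<open>w \<bullet> d\<close>, while Cauchy-Schwarz over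
  pairs of indices gives \<open>\<parallel>w\<parallel>\<^sup>2 \<le> C * sqrt F\<close> for the squared Frobenius norm \<open>F\<close>; combine the two and
  cancel \<open>C\<close>.
\<close>

lemma sum_inner_power2_le:
  fixes u :: "'i \<Rightarrow> 'a::real_inner"
  shows "(\<Sum>i\<in>I. (u i \<bullet> d)\<^sup>2) \<le> sqrt (\<Sum>i\<in>I. \<Sum>j\<in>I. (u i \<bullet> u j)\<^sup>2) * (norm d)\<^sup>2"
proof -
  define c where "c i = u i \<bullet> d" for i
  define w where "w = (\<Sum>i\<in>I. c i *\<^sub>R u i)"
  define C where "C = (\<Sum>i\<in>I. (c i)\<^sup>2)"
  define F where "F = (\<Sum>i\<in>I. \<Sum>j\<in>I. (u i \<bullet> u j)\<^sup>2)"
  have "C \<ge> 0" "F \<ge> 0"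
    by (simp_all add: C_def F_def sum_nonneg)
  have "C = w \<bullet> d"
    by (simp add: C_def w_def inner_sum_left c_def power2_eq_square)
  then have "C \<le> norm w * norm d"
    using norm_cauchy_schwarz by simp
  then have "C\<^sup>2 \<le> (norm w)\<^sup>2 * (norm d)\<^sup>2"
    using \<open>C \<ge> 0\<close> by (metis power_mono power_mult_distrib)
  moreover have "(norm w)\<^sup>2 \<le> C * sqrt F"
  proof -
    have "(norm w)\<^sup>2 = (\<Sum>i\<in>I. \<Sum>j\<in>I. (c i * c j) * (u i \<bullet> u j))"
      by (simp add: power2_norm_eq_inner w_def inner_sum_left inner_sum_right
          sum_distrib_left inner_commute mult_ac)
    also have "\<dots> = (\<Sum>p\<in>I \<times> I. (c (fst p) * c (snd p)) * (u (fst p) \<bullet> u (snd p)))"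
      by (simp add: sum.cartesian_product split_def)
    also have "\<dots> \<le> sqrt ((\<Sum>p\<in>I \<times> I. (c (fst p) * c (snd p))\<^sup>2)
        * (\<Sum>p\<in>I \<times> I. (u (fst p) \<bullet> u (snd p))\<^sup>2))"
      by (intro real_le_rsqrt Cauchy_Schwarz_ineq_sum)
    also have "(\<Sum>p\<in>I \<times> I. (c (fst p) * c (snd p))\<^sup>2) = C\<^sup>2"
      by (simp add: C_def power2_eq_square[of "sum _ _"] sum_product sum.cartesian_product split_def
          power_mult_distrib)
    also have "(\<Sum>p\<in>I \<times> I. (u (fst p) \<bullet> u (snd p))\<^sup>2) = F"
      by (simp add: F_def sum.cartesian_product split_def)
    also have "sqrt (C\<^sup>2 * F) = C * sqrt F"
      using \<open>C \<ge> 0\<close> by (simp add: real_sqrt_mult)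
    finally show ?thesis .
  qed
  ultimately have "C * C \<le> C * (sqrt F * (norm d)\<^sup>2)"
    by (smt (verit, best) mult.assoc mult_right_mono power2_eq_square zero_le_power2)
  then show ?thesis
    using \<open>C \<ge> 0\<close> \<open>F \<ge> 0\<close> unfolding C_def[unfolded c_def, symmetric] F_def[symmetric]
    by (cases "C = 0") (auto simp: mult_le_cancel_left_pos)
qed

lemma inner_eq_0_if_disjoint_supp:
  assumes "supp x \<inter> supp y = {}"
  shows "x \<bullet> y = 0"
  using assms by (auto simp: inner_vec_def supp_def intro!: sum.neutral)

text \<open>
  The diagonal of the Gram matrix contributes at most \<open>m\<close>; off the diagonal an entry is at most \<open>1\<close> in
  absolute value, and it is zero when the supports are disjoint.
\<close>

lemma sum_inner_sgn_power2_le_conflicts: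
  "(\<Sum>i=1..m. \<Sum>j=1..m. (sgn (a i) \<bullet> sgn (a j))\<^sup>2)
     \<le> real m + (\<Sum>i=1..m. conflict_degree m a i)"
proof -
  have le1: "(sgn x \<bullet> sgn y)\<^sup>2 \<le> 1" for x y :: "real ^ 'd"
  proof -
    have "\<bar>sgn x \<bullet> sgn y\<bar> \<le> norm (sgn x) * norm (sgn y)"
      by (rule Cauchy_Schwarz_ineq2)
    also have "\<dots> \<le> 1"
      by (simp add: norm_sgn)
    finally show ?thesis
      by (simp add: abs_square_le_1)
  qed
  have "(\<Sum>j=1..m. (sgn (a i) \<bullet> sgn (a j))\<^sup>2) \<le> 1 + conflict_degree m a i" if "i \<in> {1..m}" for i
  proof -
    have "(\<Sum>j=1..m. (sgn (a i) \<bullet> sgn (a j))\<^sup>2)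
        = (sgn (a i) \<bullet> sgn (a i))\<^sup>2 + (\<Sum>j\<in>{1..m} - {i}. (sgn (a i) \<bullet> sgn (a j))\<^sup>2)"
      using that by (intro sum.remove) auto
    also have "(\<Sum>j\<in>{1..m} - {i}. (sgn (a i) \<bullet> sgn (a j))\<^sup>2) \<le> conflict_degree m a i"
      unfolding conflict_degree_def
    proof (rule sum_mono)
      fix j
      show "(sgn (a i) \<bullet> sgn (a j))\<^sup>2 \<le> of_bool (supp (a i) \<inter> supp (a j) \<noteq> {})"
        using le1[of "a i" "a j"] inner_eq_0_if_disjoint_supp[of "a i" "a j"]
        by (auto simp: sgn_div_norm)
    qed
    finally show ?thesis using le1[of "a i" "a i"] by linarith
  qed
  then have "(\<Sum>i=1..m. \<Sum>j=1..m. (sgn (a i) \<bullet> sgn (a j))\<^sup>2)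
      \<le> (\<Sum>i=1..m. 1 + conflict_degree m a i)"
    by (intro sum_mono)
  then show ?thesis by (simp add: sum.distrib)
qed

lemma Delta_ave_le_Delta_max:
  assumes "1 \<le> m"
  shows "Delta_ave m a \<le> Delta_max m a"
proof -
  have "(\<Sum>i=1..m. conflict_degree m a i) \<le> (\<Sum>i=1..m. Delta_max m a)"
    unfolding Delta_max_def by (intro sum_mono Max_ge) auto
  then show ?thesis
    using assms by (simp add: Delta_ave_def field_simps)
qed

lemma Lbar_eq:
  assumes "1 \<le> m"
  shows "Lbar L m a = L * sqrt (real m + (\<Sum>i=1..m. conflict_degree m a i))"
proof -
  have "real m * (1 + Delta_ave m a) = real m + (\<Sum>i=1..m. conflict_degree m a i)"
    using assms by (simp add: Delta_ave_def field_simps)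
  then show ?thesis
    using Delta_ave_le_Delta_max[OF assms, of a] by (simp add: Lbar_def min_absorb1)
qed

lemma Lbar_pos:
  assumes "1 \<le> m" "0 < L"
  shows "0 < Lbar L m a"
proof -
  have "0 \<le> (\<Sum>i=1..m. conflict_degree m a i)"
    by (simp add: conflict_degree_def sum_nonneg)
  then show ?thesis
    using assms by (simp add: Lbar_eq add_pos_nonneg)
qed

text \<open>
  Adding up the one-dimensional bounds of the summands leaves the quadratic form
  \<open>\<Sum>\<^sub>i (sgn (a i) \<bullet> (y - x))\<^sup>2\<close>, which the conflict count controls.
\<close>

lemma convex_lipschitz_grad_sum_ridge:
  fixes a :: "nat \<Rightarrow> real ^ 'd"
  assumes m: "1 \<le> m" and L: "0 < L"
    and fi: "\<And>i. i \<in> {1..m} \<Longrightarrow> convex_lipschitz_grad L (fi i)"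
    and ridge: "\<And>i x. i \<in> {1..m} \<Longrightarrow> fi i x = g i (a i \<bullet> x)"
  shows "convex_lipschitz_grad (Lbar L m a) (\<lambda>x. \<Sum>i=1..m. fi i x)" (is "convex_lipschitz_grad _ ?f")
proof -
  have D: "GDERIV ?f x :> (\<Sum>i=1..m. grad (fi i) x)" for x
    by (intro GDERIV_sum GDERIV_grad convex_lipschitz_gradD(1)[OF fi])
  have grad_f: "grad ?f x = (\<Sum>i=1..m. grad (fi i) x)" for x
    by (rule GDERIV_grad_eq[OF D])
  have "?f x + grad ?f x \<bullet> (y - x) \<le> ?f y" for x y
  proof -
    have "(\<Sum>i=1..m. fi i x + grad (fi i) x \<bullet> (y - x)) \<le> ?f y"
      by (intro sum_mono convex_lipschitz_gradD(2)[OF fi])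
    then show ?thesis by (simp only: grad_f sum.distrib inner_sum_left)
  qed
  moreover have "?f y \<le> ?f x + grad ?f x \<bullet> (y - x) + Lbar L m a / 2 * (norm (y - x))\<^sup>2" for x y
  proof -
    have "?f y \<le> (\<Sum>i=1..m. fi i x + grad (fi i) x \<bullet> (y - x) + L / 2 * (sgn (a i) \<bullet> (y - x))\<^sup>2)"
      by (intro sum_mono ridge_upper_bound[OF fi ridge])
    also have "\<dots> = ?f x + grad ?f x \<bullet> (y - x) + L / 2 * (\<Sum>i=1..m. (sgn (a i) \<bullet> (y - x))\<^sup>2)"
      by (simp only: grad_f sum.distrib inner_sum_left sum_distrib_left)
    also have "(\<Sum>i=1..m. (sgn (a i) \<bullet> (y - x))\<^sup>2)
        \<le> sqrt (\<Sum>i=1..m. \<Sum>j=1..m. (sgn (a i) \<bullet> sgn (a j))\<^sup>2) * (norm (y - x))\<^sup>2"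
      by (rule sum_inner_power2_le)
    also have "\<dots> \<le> sqrt (real m + (\<Sum>i=1..m. conflict_degree m a i)) * (norm (y - x))\<^sup>2"
      by (intro mult_right_mono real_sqrt_le_mono sum_inner_sgn_power2_le_conflicts) simp
    finally show ?thesis
      using L by (simp add: Lbar_eq[OF m] mult_ac)
  qed
  moreover have "?f differentiable (at x)" for x
    using D unfolding gderiv_def differentiable_def by blast
  ultimately show ?thesis
    unfolding convex_lipschitz_grad_def by blast
qed

section \<open>One quantized gradient step\<close>

lemma unbiased_random_quantizer_measurable_seed:
  assumes "unbiased_random_quantizer S \<alpha> Q"
  shows "(\<lambda>s. Q s v) \<in> borel_measurable S"
proof -
  have "has_bochner_integral S (\<lambda>s. Q s v) v"
    using assms by (simp add: unbiased_random_quantizer_def)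
  then show ?thesis
    by (rule borel_measurable_has_bochner_integral)
qed

lemma quantizer_step_dist:
  fixes x y :: "real ^ 'd"
  assumes Q: "unbiased_random_quantizer S \<alpha> Q"
  shows "integrable S (\<lambda>s. (norm (x - c *\<^sub>R Q s g - y))\<^sup>2)"
    and "(LINT s|S. (norm (x - c *\<^sub>R Q s g - y))\<^sup>2)
           \<le> (norm (x - y))\<^sup>2 - 2 * c * (g \<bullet> (x - y)) + c\<^sup>2 * \<alpha> * (norm g)\<^sup>2"
proof -
  interpret prob_space S
    using Q by (simp add: unbiased_random_quantizer_def)
  have expand: "(norm (x - c *\<^sub>R Q s g - y))\<^sup>2
      = (norm (x - y))\<^sup>2 - 2 * c * (Q s g \<bullet> (x - y)) + c\<^sup>2 * (norm (Q s g))\<^sup>2" for s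
    by (simp only: power2_norm_eq_inner)
      (simp add: inner_diff_left inner_diff_right inner_commute algebra_simps power2_eq_square)
  have mean: "has_bochner_integral S (\<lambda>s. Q s g \<bullet> (x - y)) (g \<bullet> (x - y))"
    using Q by (intro has_bochner_integral_inner_left) (simp add: unbiased_random_quantizer_def)
  have sq: "integrable S (\<lambda>s. (norm (Q s g))\<^sup>2)"
    "(LINT s|S. (norm (Q s g))\<^sup>2) \<le> \<alpha> * (norm g)\<^sup>2"
    using Q by (simp_all add: unbiased_random_quantizer_def)
  show "integrable S (\<lambda>s. (norm (x - c *\<^sub>R Q s g - y))\<^sup>2)"
    unfolding expand using mean sq by (auto simp: has_bochner_integral_iff)
  have "(LINT s|S. (norm (x - c *\<^sub>R Q s g - y))\<^sup>2)
      = (norm (x - y))\<^sup>2 - 2 * c * (g \<bullet> (x - y)) + c\<^sup>2 * (LINT s|S. (norm (Q s g))\<^sup>2)"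
    unfolding expand using mean sq by (simp add: has_bochner_integral_iff prob_space)
  also have "\<dots> \<le> (norm (x - y))\<^sup>2 - 2 * c * (g \<bullet> (x - y)) + c\<^sup>2 * (\<alpha> * (norm g)\<^sup>2)"
    using sq by (intro add_left_mono mult_left_mono) auto
  finally show "(LINT s|S. (norm (x - c *\<^sub>R Q s g - y))\<^sup>2)
      \<le> (norm (x - y))\<^sup>2 - 2 * c * (g \<bullet> (x - y)) + c\<^sup>2 * \<alpha> * (norm g)\<^sup>2"
    by (simp add: mult.assoc)
qed

text \<open>
  For \<open>c = 1 / (L * \<alpha>)\<close> the second-moment term \<open>c\<^sup>2 * \<alpha> * \<parallel>grad f x\<parallel>\<^sup>2\<close> equals \<open>2 * c\<close> times the cocoercivity gain
  \<open>\<parallel>grad f x\<parallel>\<^sup>2 / (2 * L)\<close>, so the quantization noise is absorbed without loss.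
\<close>

lemma quantized_gradient_step_contraction:
  fixes x xstar :: "real ^ 'd"
  assumes Q: "unbiased_random_quantizer S \<alpha> Q"
    and f: "convex_lipschitz_grad L f" "0 < L" and min: "\<And>y. f xstar \<le> f y"
  shows "(LINT s|S. (norm (x - (1 / (L * \<alpha>)) *\<^sub>R Q s (grad f x) - xstar))\<^sup>2)
           \<le> (norm (x - xstar))\<^sup>2 - 2 * (1 / (L * \<alpha>)) * (f x - f xstar)"
proof -
  define c where "c = 1 / (L * \<alpha>)"
  have \<alpha>: "0 < \<alpha>" using Q by (simp add: unbiased_random_quantizer_def)
  then have c: "0 < c" using f by (simp add: c_def)
  have "(LINT s|S. (norm (x - c *\<^sub>R Q s (grad f x) - xstar))\<^sup>2)
      \<le> (norm (x - xstar))\<^sup>2 - 2 * c * (grad f x \<bullet> (x - xstar)) + c\<^sup>2 * \<alpha> * (norm (grad f x))\<^sup>2"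
    by (rule quantizer_step_dist[OF Q])
  also have "c\<^sup>2 * \<alpha> * (norm (grad f x))\<^sup>2 = 2 * c * ((norm (grad f x))\<^sup>2 / (2 * L))"
    using \<alpha> f by (simp add: c_def power2_eq_square)
  also have "(norm (x - xstar))\<^sup>2 - 2 * c * (grad f x \<bullet> (x - xstar)) + \<dots>
      = (norm (x - xstar))\<^sup>2 - 2 * c * (grad f x \<bullet> (x - xstar) - (norm (grad f x))\<^sup>2 / (2 * L))"
    by (simp add: algebra_simps)
  also have "\<dots> \<le> (norm (x - xstar))\<^sup>2 - 2 * c * (f x - f xstar)"
  proof -
    have "f x - f xstar \<le> grad f x \<bullet> (x - xstar) - (norm (grad f x))\<^sup>2 / (2 * L)"
      using convex_lipschitz_grad_cocoercive[OF f, of x xstar] grad_eq_0_at_minimum[OF f min]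
      by (simp add: inner_diff_right)
    then show ?thesis using c by simp
  qed
  finally show ?thesis by (simp add: c_def)
qed

text \<open>
  Reduces integrability of the optimality gap to that of the squared distance.
\<close>

lemma gap_le_dist_power2:
  assumes f: "convex_lipschitz_grad L f" "0 < L" and min: "\<And>y. f xstar \<le> f y"
  shows "f x - f xstar \<le> L / 2 * (norm (x - xstar))\<^sup>2"
proof -
  have "f x \<le> f xstar + grad f xstar \<bullet> (x - xstar) + L / 2 * (norm (x - xstar))\<^sup>2"
    by (rule convex_lipschitz_gradD(3)[OF f(1)])
  then show ?thesis by (simp add: grad_eq_0_at_minimum[OF f min])
qed

text \<open>
  In expectation the linear term of the quadratic upper bound decreases \<open>f\<close> by \<open>c * \<parallel>grad f x\<parallel>\<^sup>2\<close>, and for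
  \<open>c = 1 / (L * \<alpha>)\<close> the second-moment term gives back only half of that.
\<close>

lemma quantized_gradient_step_descent:
  fixes x xstar :: "real ^ 'd"
  assumes Q: "unbiased_random_quantizer S \<alpha> Q"
    and f: "convex_lipschitz_grad L f" "0 < L" and min: "\<And>y. f xstar \<le> f y"
  shows "integrable S (\<lambda>s. f (x - (1 / (L * \<alpha>)) *\<^sub>R Q s (grad f x)) - f xstar)"
    and "(LINT s|S. f (x - (1 / (L * \<alpha>)) *\<^sub>R Q s (grad f x)) - f xstar) \<le> f x - f xstar"
proof -
  interpret prob_space S
    using Q by (simp add: unbiased_random_quantizer_def)
  note [measurable] = unbiased_random_quantizer_measurable_seed[OF Q]
    borel_measurable_convex_lipschitz_grad[OF f(1)]
  define c where "c = 1 / (L * \<alpha>)"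
  define g where "g = grad f x"
  have \<alpha>: "0 < \<alpha>" using Q by (simp add: unbiased_random_quantizer_def)
  have int: "integrable S (\<lambda>s. f (x - c *\<^sub>R Q s g) - f xstar)"
  proof (rule Bochner_Integration.integrable_bound)
    show "integrable S (\<lambda>s. L / 2 * (norm (x - c *\<^sub>R Q s g - xstar))\<^sup>2)"
      by (intro integrable_mult_right quantizer_step_dist[OF Q])
    show "AE s in S. norm (f (x - c *\<^sub>R Q s g) - f xstar)
        \<le> norm (L / 2 * (norm (x - c *\<^sub>R Q s g - xstar))\<^sup>2)"
      using gap_le_dist_power2[OF f min] min f(2) by (intro AE_I2) simp
  qed measurable
  then show "integrable S (\<lambda>s. f (x - (1 / (L * \<alpha>)) *\<^sub>R Q s (grad f x)) - f xstar)"
    by (simp add: c_def g_def)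
  have mean: "has_bochner_integral S (\<lambda>s. g \<bullet> Q s g) (g \<bullet> g)"
    using Q by (intro has_bochner_integral_inner_right) (simp add: unbiased_random_quantizer_def)
  have sq: "integrable S (\<lambda>s. (norm (Q s g))\<^sup>2)"
    "(LINT s|S. (norm (Q s g))\<^sup>2) \<le> \<alpha> * (norm g)\<^sup>2"
    using Q by (simp_all add: unbiased_random_quantizer_def)
  have "(LINT s|S. f (x - c *\<^sub>R Q s g) - f xstar)
      \<le> (LINT s|S. (f x - f xstar) - c * (g \<bullet> Q s g) + L / 2 * c\<^sup>2 * (norm (Q s g))\<^sup>2)"
  proof (rule integral_mono[OF int])
    show "integrable S (\<lambda>s. (f x - f xstar) - c * (g \<bullet> Q s g) + L / 2 * c\<^sup>2 * (norm (Q s g))\<^sup>2)"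
      using mean sq by (auto simp: has_bochner_integral_iff)
    fix s
    have "f (x - c *\<^sub>R Q s g)
        \<le> f x + g \<bullet> ((x - c *\<^sub>R Q s g) - x) + L / 2 * (norm ((x - c *\<^sub>R Q s g) - x))\<^sup>2"
      unfolding g_def by (rule convex_lipschitz_gradD(3)[OF f(1)])
    then show "f (x - c *\<^sub>R Q s g) - f xstar
        \<le> (f x - f xstar) - c * (g \<bullet> Q s g) + L / 2 * c\<^sup>2 * (norm (Q s g))\<^sup>2"
      by (simp add: power_mult_distrib mult.assoc)
  qed
  also have "\<dots> = (f x - f xstar) - c * (norm g)\<^sup>2 + L / 2 * c\<^sup>2 * (LINT s|S. (norm (Q s g))\<^sup>2)"
    using mean sq by (simp add: has_bochner_integral_iff prob_space power2_norm_eq_inner)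
  also have "\<dots> \<le> (f x - f xstar) - c * (norm g)\<^sup>2 + L / 2 * c\<^sup>2 * (\<alpha> * (norm g)\<^sup>2)"
    using sq f by (intro add_left_mono mult_left_mono) auto
  also have "\<dots> = (f x - f xstar) - c / 2 * (norm g)\<^sup>2"
    using \<alpha> f by (simp add: c_def power2_eq_square)
  also have "\<dots> \<le> f x - f xstar"
    using \<alpha> f by (simp add: c_def)
  finally show "(LINT s|S. f (x - (1 / (L * \<alpha>)) *\<^sub>R Q s (grad f x)) - f xstar) \<le> f x - f xstar"
    by (simp add: c_def g_def)
qed

section \<open>Fresh randomness\<close>

text \<open>
  A conditional estimate for each fixed value of \<open>X\<close> survives averaging over \<open>X\<close> when the seed is
  independent of it. Independence is expressed by the joint law, since \<open>X\<close> and the seed take values in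
  different types, whereas \<open>indep_var\<close> relates variables of one type. For nonnegative \<open>h\<close>, Tonelli's theorem yields integrability
  together with the bound.
\<close>

lemma (in prob_space) expectation_fresh_seed_le:
  fixes h :: "'b \<Rightarrow> 's \<Rightarrow> real"
  assumes S: "prob_space S"
    and X: "X \<in> measurable M N" and \<xi>: "\<xi> \<in> measurable M S"
    and joint: "distr M (N \<Otimes>\<^sub>M S) (\<lambda>\<omega>. (X \<omega>, \<xi> \<omega>)) = distr M N X \<Otimes>\<^sub>M S"
    and h: "(\<lambda>(x, s). h x s) \<in> borel_measurable (N \<Otimes>\<^sub>M S)"
    and nonneg: "\<And>x s. 0 \<le> h x s"
    and int: "\<And>x. integrable S (h x)" and le: "\<And>x. (LINT s|S. h x s) \<le> \<phi> x"
    and \<phi>: "integrable M (\<lambda>\<omega>. \<phi> (X \<omega>))"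
  shows "integrable M (\<lambda>\<omega>. h (X \<omega>) (\<xi> \<omega>))"
    and "(LINT \<omega>|M. h (X \<omega>) (\<xi> \<omega>)) \<le> (LINT \<omega>|M. \<phi> (X \<omega>))"
proof -
  interpret S: prob_space S
    by (rule S)
  note [measurable] = X \<xi> h
  have \<phi>_nonneg: "0 \<le> \<phi> x" for x
    using nonneg by (intro order_trans[OF Bochner_Integration.integral_nonneg le])
  have "(\<integral>\<^sup>+\<omega>. h (X \<omega>) (\<xi> \<omega>) \<partial>M)
      = (\<integral>\<^sup>+p. ennreal (case p of (x, s) \<Rightarrow> h x s) \<partial>distr M (N \<Otimes>\<^sub>M S) (\<lambda>\<omega>. (X \<omega>, \<xi> \<omega>)))"
    by (subst nn_integral_distr) auto
  also have "\<dots> = (\<integral>\<^sup>+x. \<integral>\<^sup>+s. ennreal (h x s) \<partial>S \<partial>distr M N X)"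
    unfolding joint by (subst S.nn_integral_fst[symmetric]) auto
  also have "\<dots> = (\<integral>\<^sup>+\<omega>. \<integral>\<^sup>+s. ennreal (h (X \<omega>) s) \<partial>S \<partial>M)"
    by (subst nn_integral_distr) auto
  also have "\<dots> \<le> (\<integral>\<^sup>+\<omega>. ennreal (\<phi> (X \<omega>)) \<partial>M)"
    using int le nonneg by (intro nn_integral_mono) (simp add: nn_integral_eq_integral ennreal_leI)
  also have "\<dots> = ennreal (LINT \<omega>|M. \<phi> (X \<omega>))"
    using \<phi> \<phi>_nonneg by (intro nn_integral_eq_integral) auto
  finally have *: "(\<integral>\<^sup>+\<omega>. h (X \<omega>) (\<xi> \<omega>) \<partial>M) \<le> ennreal (LINT \<omega>|M. \<phi> (X \<omega>))" .
  show I: "integrable M (\<lambda>\<omega>. h (X \<omega>) (\<xi> \<omega>))"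
    using * nonneg by (intro integrableI_nonneg) (auto simp: le_less_trans)
  have "ennreal (LINT \<omega>|M. h (X \<omega>) (\<xi> \<omega>)) \<le> ennreal (LINT \<omega>|M. \<phi> (X \<omega>))"
    using * I nonneg by (simp add: nn_integral_eq_integral)
  then show "(LINT \<omega>|M. h (X \<omega>) (\<xi> \<omega>)) \<le> (LINT \<omega>|M. \<phi> (X \<omega>))"
    using \<phi>_nonneg by (simp add: ennreal_le_iff)
qed

lemma quantized_gd_cong:
  assumes "\<And>j. j < k \<Longrightarrow> s j = t j"
  shows "quantized_gd Q f \<gamma> x0 s k = quantized_gd Q f \<gamma> x0 t k"
  using assms by (induction k) auto

lemma measurable_quantized_gd:
  fixes Q :: "'s \<Rightarrow> real ^ 'd \<Rightarrow> real ^ 'd"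
  assumes Q: "(\<lambda>(s, v). Q s v) \<in> borel_measurable (S \<Otimes>\<^sub>M borel)"
    and g: "grad f \<in> borel_measurable borel" and "n \<le> k"
  shows "(\<lambda>s. quantized_gd Q f \<gamma> x0 s n) \<in> borel_measurable (PiM {..<k} (\<lambda>_. S))"
  using \<open>n \<le> k\<close>
proof (induction n)
  case (Suc n)
  have [measurable]: "(\<lambda>s. quantized_gd Q f \<gamma> x0 s n) \<in> borel_measurable (PiM {..<k} (\<lambda>_. S))"
    using Suc by simp
  have [measurable]: "(\<lambda>s. s n) \<in> measurable (PiM {..<k} (\<lambda>_. S)) S"
    using Suc.prems by (intro measurable_component_singleton) auto
  note [measurable] = Q g
  have "(\<lambda>s. case (s n, grad f (quantized_gd Q f \<gamma> x0 s n)) of (r, v) \<Rightarrow> Q r v)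
      \<in> borel_measurable (PiM {..<k} (\<lambda>_. S))"
    by measurable
  then show ?case by simp
qed simp

text \<open>
  The iterate \<open>X\<close> is a measurable function of the block of seeds before \<open>k\<close>, and the current seed is the
  only component of the block \<open>{k}\<close>. The two blocks are independent and have the same type of values, so
  their joint law is a product; its image under the two maps is the product of the images.
\<close>

lemma joint_law_quantized_gd:
  fixes Q :: "'s \<Rightarrow> real ^ 'd \<Rightarrow> real ^ 'd"
  assumes Q: "(\<lambda>(s, v). Q s v) \<in> borel_measurable (S \<Otimes>\<^sub>M borel)"
    and g: "grad f \<in> borel_measurable borel" and \<xi>: "fresh_seeds M S \<xi>"
    and X: "\<And>\<omega>. X \<omega> = quantized_gd Q f \<gamma> x0 (\<lambda>j. \<xi> j \<omega>) k"
  shows "X \<in> borel_measurable M" and "\<xi> k \<in> measurable M S"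
    and "distr M (borel \<Otimes>\<^sub>M S) (\<lambda>\<omega>. (X \<omega>, \<xi> k \<omega>)) = distr M borel X \<Otimes>\<^sub>M S"
proof -
  interpret prob_space M
    using \<xi> by (simp add: fresh_seeds_def)
  define past where "past \<omega> = (\<lambda>j\<in>{..<k}. \<xi> j \<omega>)" for \<omega>
  define present where "present \<omega> = (\<lambda>j\<in>{k}. \<xi> j \<omega>)" for \<omega>
  define F where "F s = quantized_gd Q f \<gamma> x0 s k" for s
  let ?P = "PiM {..<k} (\<lambda>_. S)" and ?K = "PiM {k} (\<lambda>_. S)"
  have "indep_var ?P past ?K present"
    using \<xi> unfolding past_def[abs_def] present_def[abs_def]
    by (intro indep_var_restrict[where I = UNIV]) (auto simp: fresh_seeds_def)
  then have [measurable]: "past \<in> measurable M ?P" "present \<in> measurable M ?K"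
    and joint: "distr M ?P past \<Otimes>\<^sub>M distr M ?K present = distr M (?P \<Otimes>\<^sub>M ?K) (\<lambda>\<omega>. (past \<omega>, present \<omega>))"
    by (simp_all add: indep_var_distribution_eq)
  have [measurable]: "F \<in> borel_measurable ?P"
    unfolding F_def[abs_def] by (rule measurable_quantized_gd[OF Q g order_refl])
  have [measurable]: "(\<lambda>s. s k) \<in> measurable ?K S"
    by (intro measurable_component_singleton) simp
  have X_eq: "X \<omega> = F (past \<omega>)" for \<omega>
    by (auto simp: X F_def past_def intro!: quantized_gd_cong)
  have \<xi>_eq: "\<xi> k \<omega> = present \<omega> k" for \<omega>
    by (simp add: present_def)
  show "X \<in> borel_measurable M"
    unfolding X_eq[abs_def] by measurable
  have "(\<lambda>\<omega>. present \<omega> k) \<in> measurable M S"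
    by measurable
  then show \<xi>k: "\<xi> k \<in> measurable M S"
    by (simp flip: \<xi>_eq)
  have \<xi>_distr: "distr M S (\<xi> k) = S"
    using \<xi> by (simp add: fresh_seeds_def)
  then have K: "distr (distr M ?K present) S (\<lambda>s. s k) = S"
    by (simp add: distr_distr comp_def flip: \<xi>_eq)
  have "prob_space S"
    using prob_space_distr[OF \<xi>k] \<xi>_distr by simp
  then have "sigma_finite_measure (distr (distr M ?K present) S (\<lambda>s. s k))"
    unfolding K by (rule prob_space_imp_sigma_finite)
  then have "distr (distr M ?P past) borel F \<Otimes>\<^sub>M distr (distr M ?K present) S (\<lambda>s. s k)
      = distr (distr M ?P past \<Otimes>\<^sub>M distr M ?K present) (borel \<Otimes>\<^sub>M S) (\<lambda>(s, t). (F s, t k))"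
    by (intro pair_measure_distr) simp_all
  also have "\<dots> = distr M (borel \<Otimes>\<^sub>M S) (\<lambda>\<omega>. (F (past \<omega>), present \<omega> k))"
    unfolding joint by (simp add: distr_distr comp_def)
  finally show "distr M (borel \<Otimes>\<^sub>M S) (\<lambda>\<omega>. (X \<omega>, \<xi> k \<omega>)) = distr M borel X \<Otimes>\<^sub>M S"
    unfolding K by (simp add: distr_distr comp_def flip: X_eq \<xi>_eq)
qed

section \<open>The convergence rate\<close>

lemma quantized_gd_convergence:
  fixes Q :: "'s \<Rightarrow> real ^ 'd \<Rightarrow> real ^ 'd" and x0 xstar :: "real ^ 'd"
  assumes f: "convex_lipschitz_grad L f" "0 < L" and min: "\<And>y. f xstar \<le> f y"
    and Q: "unbiased_random_quantizer S \<alpha> Q" and \<xi>: "fresh_seeds M S \<xi>"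
    and \<gamma>: "\<And>k. \<gamma> k = 1 / (L * \<alpha>)"
    and X: "\<And>k \<omega>. X k \<omega> = quantized_gd Q f \<gamma> x0 (\<lambda>j. \<xi> j \<omega>) k"
  shows "integrable M (\<lambda>\<omega>. f (X T \<omega>) - f xstar)"
    and "(LINT \<omega>|M. f (X T \<omega>) - f xstar) \<le> \<alpha> * L / (2 * (real T + 1)) * (norm (x0 - xstar))\<^sup>2"
proof -
  interpret prob_space M
    using \<xi> by (simp add: fresh_seeds_def)
  define c where "c = 1 / (L * \<alpha>)"
  have \<alpha>: "0 < \<alpha>" using Q by (simp add: unbiased_random_quantizer_def)
  then have c: "0 < c" using f by (simp add: c_def)
  define D where "D k = (LINT \<omega>|M. (norm (X k \<omega> - xstar))\<^sup>2)" for k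
  define G where "G k = (LINT \<omega>|M. f (X k \<omega>) - f xstar)" for k
  note measurable_f = borel_measurable_convex_lipschitz_grad[OF f(1)]
  note measurable_grad = borel_measurable_grad[OF f]
  have Q_meas: "(\<lambda>(s, v). Q s v) \<in> borel_measurable (S \<Otimes>\<^sub>M borel)"
    using Q by (simp add: unbiased_random_quantizer_def)
  have X_Suc: "X (Suc k) \<omega> = X k \<omega> - c *\<^sub>R Q (\<xi> k \<omega>) (grad f (X k \<omega>))" for k \<omega>
    by (simp add: X \<gamma> c_def)
  have S: "prob_space S"
    using Q by (simp add: unbiased_random_quantizer_def)
  note fresh = joint_law_quantized_gd[OF Q_meas measurable_grad \<xi> X]
  have step_meas: "(\<lambda>(x, s). x - c *\<^sub>R Q s (grad f x)) \<in> borel_measurable (borel \<Otimes>\<^sub>M S)"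
  proof -
    note [measurable] = Q_meas measurable_grad
    have "(\<lambda>p. fst p - c *\<^sub>R (case (snd p, grad f (fst p)) of (s, v) \<Rightarrow> Q s v))
        \<in> borel_measurable (borel \<Otimes>\<^sub>M S)"
      by measurable
    then show ?thesis by (simp add: split_def)
  qed
  have dist_step: "integrable M (\<lambda>\<omega>. (norm (X (Suc k) \<omega> - xstar))\<^sup>2)" "D (Suc k) \<le> D k - 2 * c * G k"
    if "integrable M (\<lambda>\<omega>. (norm (X k \<omega> - xstar))\<^sup>2)" "integrable M (\<lambda>\<omega>. f (X k \<omega>) - f xstar)" for k
  proof -
    have meas: "(\<lambda>(x, s). (norm (x - c *\<^sub>R Q s (grad f x) - xstar))\<^sup>2) \<in> borel_measurable (borel \<Otimes>\<^sub>M S)"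
      using step_meas by (simp add: split_def)
    note * = expectation_fresh_seed_le[OF S fresh[of k] meas _ quantizer_step_dist(1)[OF Q]
        quantized_gradient_step_contraction[OF Q f min, folded c_def]]
    show "integrable M (\<lambda>\<omega>. (norm (X (Suc k) \<omega> - xstar))\<^sup>2)"
      unfolding X_Suc by (rule *(1)) (use that in auto)
    have "D (Suc k) \<le> (LINT \<omega>|M. (norm (X k \<omega> - xstar))\<^sup>2 - 2 * c * (f (X k \<omega>) - f xstar))"
      unfolding X_Suc D_def by (rule *(2)) (use that in auto)
    also have "\<dots> = D k - 2 * c * G k"
      unfolding D_def G_def using that
      by (subst Bochner_Integration.integral_diff) auto
    finally show "D (Suc k) \<le> D k - 2 * c * G k" .
  qed
  have gap_step: "integrable M (\<lambda>\<omega>. f (X (Suc k) \<omega>) - f xstar)" "G (Suc k) \<le> G k"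
    if "integrable M (\<lambda>\<omega>. f (X k \<omega>) - f xstar)" for k
  proof -
    have meas: "(\<lambda>(x, s). f (x - c *\<^sub>R Q s (grad f x)) - f xstar) \<in> borel_measurable (borel \<Otimes>\<^sub>M S)"
      using measurable_compose[OF step_meas measurable_f] by (simp add: split_def)
    note * = expectation_fresh_seed_le[OF S fresh[of k] meas _
        quantized_gradient_step_descent[OF Q f min, folded c_def]]
    show "integrable M (\<lambda>\<omega>. f (X (Suc k) \<omega>) - f xstar)"
      unfolding X_Suc by (rule *(1)) (use that min in auto)
    show "G (Suc k) \<le> G k"
      unfolding X_Suc G_def by (rule *(2)) (use that min in auto)
  qed
  have X_0: "X 0 \<omega> = x0" for \<omega> by (simp add: X)
  have int: "integrable M (\<lambda>\<omega>. (norm (X k \<omega> - xstar))\<^sup>2)" "integrable M (\<lambda>\<omega>. f (X k \<omega>) - f xstar)"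
    for k
    by (induction k) (simp_all add: X_0 dist_step(1) gap_step(1))
  then show "integrable M (\<lambda>\<omega>. f (X T \<omega>) - f xstar)" by blast
  \<comment> \<open>Descent pays for replacing \<open>G k\<close> by \<open>G (Suc k)\<close> in the first term, and the drop of \<open>D\<close> pays for
    raising the factor \<open>k\<close> by one.\<close>
  have lyapunov: "2 * c * real k * G k + D k \<le> D 0" for k
  proof (induction k)
    case (Suc k)
    have "2 * c * real (Suc k) * G (Suc k) \<le> 2 * c * real (Suc k) * G k"
      using gap_step(2)[OF int(2)] c by (intro mult_left_mono) auto
    also have "\<dots> = 2 * c * real k * G k + 2 * c * G k"
      by (simp add: algebra_simps)
    finally show ?case
      using dist_step(2)[OF int, of k] Suc by linarith
  qed simp
  have "0 \<le> D (Suc T)"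
    by (simp add: D_def)
  then have "2 * c * real T * G T + 2 * c * G T \<le> D 0"
    using lyapunov[of T] dist_step(2)[OF int, of T] by linarith
  then have "2 * c * (real T + 1) * G T \<le> (norm (x0 - xstar))\<^sup>2"
    by (simp add: D_def X_0 prob_space algebra_simps)
  then show "(LINT \<omega>|M. f (X T \<omega>) - f xstar) \<le> \<alpha> * L / (2 * (real T + 1)) * (norm (x0 - xstar))\<^sup>2"
    unfolding G_def[symmetric] using \<alpha> f by (simp add: c_def field_simps)
qed

theorem theorem4p3:
  fixes m :: nat
    and fi :: "nat \<Rightarrow> real ^ 'd \<Rightarrow> real"
    and f :: "real ^ 'd \<Rightarrow> real"
    and l :: "real \<Rightarrow> real \<Rightarrow> real"
    and a :: "nat \<Rightarrow> real ^ 'd"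
    and b :: "nat \<Rightarrow> real"
    and L \<alpha> :: real
    and \<gamma> :: "nat \<Rightarrow> real"
    and Q :: "'s \<Rightarrow> real ^ 'd \<Rightarrow> real ^ 'd"
    and S :: "'s measure"
    and M :: "'w measure"
    and \<xi> :: "nat \<Rightarrow> 'w \<Rightarrow> 's"
    and X :: "nat \<Rightarrow> 'w \<Rightarrow> real ^ 'd"
    and x0 xstar :: "real ^ 'd"
    and T :: nat
  assumes "1 \<le> m" and "0 < L"
    and "\<And>x. f x = (\<Sum>i=1..m. fi i x)"
    and "\<And>i. i \<in> {1..m} \<Longrightarrow> convex_lipschitz_grad L (fi i)"
    and "\<And>i x. i \<in> {1..m} \<Longrightarrow> fi i x = l (a i \<bullet> x) (b i)"
    and "\<And>i x. i \<in> {1..m} \<Longrightarrow> supp (grad (fi i) x) = supp (a i)"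
    and "is_arg_min f (\<lambda>_. True) xstar"
    and "unbiased_random_quantizer S \<alpha> Q"
    and "fresh_seeds M S \<xi>"
    and "\<And>k. \<gamma> k = 1 / (Lbar L m a * \<alpha>)"
    and "\<And>k \<omega>. X k \<omega> = quantized_gd Q f \<gamma> x0 (\<lambda>j. \<xi> j \<omega>) k"
  shows "integrable M (\<lambda>\<omega>. f (X T \<omega>) - f xstar) \<and>
    (LINT \<omega>|M. f (X T \<omega>) - f xstar)
      \<le> \<alpha> * Lbar L m a / (2 * (real T + 1)) * (norm (x0 - xstar))\<^sup>2"
proof -
  have f: "f = (\<lambda>x. \<Sum>i=1..m. fi i x)"
    using assms(3) by blast
  have "convex_lipschitz_grad (Lbar L m a) f"
    unfolding f by (rule convex_lipschitz_grad_sum_ridge[OF assms(1,2,4,5)])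
  moreover have "f xstar \<le> f y" for y
    using assms(7) by (simp add: is_arg_min_linorder)
  ultimately show ?thesis
    using quantized_gd_convergence[OF _ Lbar_pos[OF assms(1,2)] _ assms(8,9,10,11)] by blast
qed

end
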